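(* Let $\Gamma$ be a simplicial complex of dimension $d-1$ with $n\ge 9d+1$ vertices. Then $\Gamma$ satisfies the Taylor upper bound conjecture without equality, that is, $$f_{d-1}(\Gamma)<\frac{1}{(n-d)!}\prod_{i=1}^{n-d}\tilde M_i(\Gamma).$$
   Context: A simplicial complex $\Gamma$ on $[n]=\{1,\dots,n\}$ is a collection of subsets (faces) closed under inclusion and containing all singletons; a face $F$ has dimension $|F|-1$, the dimension of $\Gamma$ is the largest dimension of a face, and $f_{d-1}(\Gamma)$ is the number of faces of dimension $d-1$. $I_\Gamma\subset\mathbf{k}[x_1,\dots,x_n]$ ($\mathbf{k}$ a field) is the Stanley-Reisner ideal, generated by the squarefree monomials corresponding to non-faces; it has codimension $n-d$ and its quotient has multiplicity $f_{d-1}(\Gamma)$. $\mathrm{GEN}(I_\Gamma)$ is the set of minimal monomial generators of $I_\Gamma$, and $\tilde M_i(\Gamma)=\max\{\deg\operatorname{lcm}(T):T\subset\mathrm{GEN}(I_\Gamma),\ |T|=i\}$ is the $i$-th maximal shift of the Taylor resolution. *)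

theory Defs
  imports Complex_Main "HOL-Library.Poly_Mapping" "HOL-Algebra.Ideal"
begin

definition simplicial_complex_on :: "nat \<Rightarrow> nat set set \<Rightarrow> bool" where
  "simplicial_complex_on n \<Gamma> \<longleftrightarrow>
     \<Gamma> \<subseteq> Pow {1..n} \<and>
     (\<forall>F\<in>\<Gamma>. \<forall>G. G \<subseteq> F \<longrightarrow> G \<in> \<Gamma>) \<and>
     (\<forall>i\<in>{1..n}. {i} \<in> \<Gamma>)"

text \<open>Dimensions are integers, since the empty face has dimension \<open>-1\<close>.\<close>

definition face_dim :: "nat set \<Rightarrow> int" where
  "face_dim F = int (card F) - 1"

definition complex_dim :: "nat set set \<Rightarrow> int" where
  "complex_dim \<Gamma> = Max (face_dim ` \<Gamma>)"

definition face_number :: "int \<Rightarrow> nat set set \<Rightarrow> nat" where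
  "face_number k \<Gamma> = card {F \<in> \<Gamma>. face_dim F = k}"

text \<open>A monomial is given by its exponent vector, and a polynomial by its finitely supported
  family of coefficients; multiplication of polynomials is the convolution product of
  \<^typ>\<open>'a \<Rightarrow>\<^sub>0 'b\<close>.\<close>

type_synonym mon = "nat \<Rightarrow>\<^sub>0 nat"
type_synonym 'k mpoly = "mon \<Rightarrow>\<^sub>0 'k"

definition monomials :: "nat \<Rightarrow> mon set" where
  "monomials n = {m. Poly_Mapping.keys m \<subseteq> {1..n}}"

definition mon_poly :: "mon \<Rightarrow> 'k::field mpoly" where
  "mon_poly m = Poly_Mapping.single m 1"

definition poly_ring :: "nat \<Rightarrow> 'k::field mpoly ring" where
  "poly_ring n =
     \<lparr>carrier = {p. Poly_Mapping.keys p \<subseteq> monomials n},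
      monoid.mult = (*), one = 1, zero = 0, add = (+)\<rparr>"

lemma monomials_add: "a \<in> monomials n \<Longrightarrow> b \<in> monomials n \<Longrightarrow> a + b \<in> monomials n"
  using Poly_Mapping.keys_add[of a b] unfolding monomials_def by blast

lemma cring_poly_ring: "cring (poly_ring n :: 'k::field mpoly ring)"
proof (rule cringI)
  show "abelian_group (poly_ring n :: 'k mpoly ring)"
  proof (rule abelian_groupI)
    fix x y :: "'k mpoly"
    assume "x \<in> carrier (poly_ring n)" "y \<in> carrier (poly_ring n)"
    then show "x \<oplus>\<^bsub>poly_ring n\<^esub> y \<in> carrier (poly_ring n)"
      using Poly_Mapping.keys_add[of x y] by (auto simp: poly_ring_def)
  next
    fix x :: "'k mpoly"
    assume "x \<in> carrier (poly_ring n)"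
    then show "\<exists>y\<in>carrier (poly_ring n). y \<oplus>\<^bsub>poly_ring n\<^esub> x = \<zero>\<^bsub>poly_ring n\<^esub>"
      by (intro bexI[of _ "- x"]) (auto simp: poly_ring_def)
  qed (auto simp: poly_ring_def algebra_simps)
  show "comm_monoid (poly_ring n :: 'k mpoly ring)"
  proof (rule comm_monoidI)
    fix x y :: "'k mpoly"
    assume "x \<in> carrier (poly_ring n)" "y \<in> carrier (poly_ring n)"
    then show "x \<otimes>\<^bsub>poly_ring n\<^esub> y \<in> carrier (poly_ring n)"
      using Poly_Mapping.keys_mult[of x y] monomials_add unfolding poly_ring_def by fastforce
  qed (auto simp: poly_ring_def algebra_simps monomials_def)
qed (auto simp: poly_ring_def algebra_simps)

definition squarefree_mon :: "nat set \<Rightarrow> mon" where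
  "squarefree_mon F = (\<Sum>i\<in>F. Poly_Mapping.single i 1)"

definition stanley_reisner_ideal :: "nat \<Rightarrow> nat set set \<Rightarrow> 'k::field mpoly set" where
  "stanley_reisner_ideal n \<Gamma> =
     Idl\<^bsub>poly_ring n\<^esub> {mon_poly (squarefree_mon F) | F. F \<subseteq> {1..n} \<and> F \<notin> \<Gamma>}"

definition minimal_monomial_generating_set :: "nat \<Rightarrow> 'k::field mpoly set \<Rightarrow> mon set \<Rightarrow> bool" where
  "minimal_monomial_generating_set n I G \<longleftrightarrow>
     G \<subseteq> monomials n \<and>
     Idl\<^bsub>poly_ring n\<^esub> (mon_poly ` G) = I \<and>
     (\<forall>H. H \<subset> G \<longrightarrow> Idl\<^bsub>poly_ring n\<^esub> (mon_poly ` H) \<noteq> I)"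

lemma genideal_monomials_dvd:
  fixes p :: "'k::field mpoly"
  assumes G: "G \<subseteq> monomials n" and p: "p \<in> Idl\<^bsub>poly_ring n\<^esub> (mon_poly ` G)"
    and m: "m \<in> Poly_Mapping.keys p"
  shows "\<exists>g\<in>G. \<exists>h\<in>monomials n. m = g + h"
proof -
  interpret R: cring "poly_ring n :: 'k mpoly ring" by (rule cring_poly_ring)
  define J :: "'k mpoly set" where
    "J = {p. \<forall>m\<in>Poly_Mapping.keys p. \<exists>g\<in>G. \<exists>h\<in>monomials n. m = g + h}"
  have Jc: "J \<subseteq> carrier (poly_ring n)"
    using G monomials_add unfolding J_def poly_ring_def by fastforce
  have uminus: "\<ominus>\<^bsub>poly_ring n\<^esub> x = - x" if "x \<in> carrier (poly_ring n)" for x :: "'k mpoly"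
    using that by (intro R.minus_equality) (auto simp: poly_ring_def)
  have mult: "x * a \<in> J" if a: "a \<in> J" and x: "x \<in> carrier (poly_ring n)" for a x :: "'k mpoly"
    unfolding J_def
  proof (intro CollectI ballI)
    fix m assume "m \<in> Poly_Mapping.keys (x * a)"
    then obtain b c where bc: "m = b + c" "b \<in> Poly_Mapping.keys x" "c \<in> Poly_Mapping.keys a"
      using Poly_Mapping.keys_mult[of x a] by blast
    then obtain g h where "g \<in> G" "h \<in> monomials n" "c = g + h"
      using a unfolding J_def by blast
    moreover have "b \<in> monomials n"
      using bc x by (auto simp: poly_ring_def)
    ultimately have "m = g + (b + h)" "b + h \<in> monomials n"
      using bc by (auto simp: algebra_simps intro: monomials_add)
    then show "\<exists>g\<in>G. \<exists>h\<in>monomials n. m = g + h"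
      using \<open>g \<in> G\<close> by blast
  qed
  have "ideal J (poly_ring n)"
  proof (rule idealI[OF R.ring_axioms])
    show "subgroup J (add_monoid (poly_ring n :: 'k mpoly ring))"
    proof (rule R.add.subgroupI)
      show "J \<noteq> {}" by (auto simp: J_def intro!: exI[of _ 0])
      show "J \<subseteq> carrier (poly_ring n)" by (rule Jc)
      show "\<ominus>\<^bsub>poly_ring n\<^esub> a \<in> J" if "a \<in> J" for a
      proof -
        have "\<ominus>\<^bsub>poly_ring n\<^esub> a = - a" using that Jc by (intro uminus) auto
        then show ?thesis using that by (simp add: J_def)
      qed
      show "a \<oplus>\<^bsub>poly_ring n\<^esub> b \<in> J" if "a \<in> J" "b \<in> J" for a b
        using that Poly_Mapping.keys_add[of a b] unfolding J_def poly_ring_def by fastforce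
    qed
    fix a x :: "'k mpoly"
    assume "a \<in> J" "x \<in> carrier (poly_ring n)"
    from mult[OF this] show "x \<otimes>\<^bsub>poly_ring n\<^esub> a \<in> J" "a \<otimes>\<^bsub>poly_ring n\<^esub> x \<in> J"
      by (simp_all add: poly_ring_def mult.commute)
  qed
  moreover have "mon_poly ` G \<subseteq> J"
  proof
    fix p :: "'k mpoly"
    assume "p \<in> mon_poly ` G"
    then obtain g where "g \<in> G" "p = mon_poly g" by blast
    moreover have "0 \<in> monomials n" "g = g + 0" by (simp_all add: monomials_def)
    ultimately have "\<exists>g'\<in>G. \<exists>h\<in>monomials n. g = g' + h" by blast
    then show "p \<in> J" using \<open>p = mon_poly g\<close> by (simp add: J_def mon_poly_def)
  qed
  ultimately have "Idl\<^bsub>poly_ring n\<^esub> (mon_poly ` G) \<subseteq> J"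
    by (rule R.genideal_minimal)
  then show ?thesis using p m unfolding J_def by blast
qed

lemma minimal_monomial_generating_set_subset:
  fixes I :: "'k::field mpoly set"
  assumes G: "minimal_monomial_generating_set n I G"
    and H: "minimal_monomial_generating_set n I H"
  shows "G \<subseteq> H"
proof
  fix g assume g: "g \<in> G"
  interpret R: cring "poly_ring n :: 'k mpoly ring" by (rule cring_poly_ring)
  have carr: "mon_poly ` A \<subseteq> (carrier (poly_ring n) :: 'k mpoly set)" if "A \<subseteq> monomials n" for A
    using that by (auto simp: poly_ring_def mon_poly_def)
  have Gm: "G \<subseteq> monomials n" and IG: "Idl\<^bsub>poly_ring n\<^esub> (mon_poly ` G) = I"
    and Hm: "H \<subseteq> monomials n" and IH: "Idl\<^bsub>poly_ring n\<^esub> (mon_poly ` H) = I"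
    using G H by (auto simp: minimal_monomial_generating_set_def)
  have *: "\<exists>b\<in>B. \<exists>h\<in>monomials n. a = b + h"
    if "a \<in> A" "A \<subseteq> monomials n" "B \<subseteq> monomials n"
      "Idl\<^bsub>poly_ring n\<^esub> (mon_poly ` A) = I" "Idl\<^bsub>poly_ring n\<^esub> (mon_poly ` B) = I" for a A B
  proof (rule genideal_monomials_dvd[OF that(3)])
    show "(mon_poly a :: 'k mpoly) \<in> Idl\<^bsub>poly_ring n\<^esub> (mon_poly ` B)"
      using R.genideal_self[OF carr[OF that(2)]] that by auto
  qed (simp add: mon_poly_def)
  obtain h u where h: "h \<in> H" "u \<in> monomials n" "g = h + u"
    using *[OF g Gm Hm IG IH] by blast
  obtain g' v where g': "g' \<in> G" "v \<in> monomials n" "h = g' + v"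
    using *[OF h(1) Hm Gm IH IG] by blast
  have "g' = g"
  proof (rule ccontr)
    assume ne: "g' \<noteq> g"
    let ?J = "Idl\<^bsub>poly_ring n\<^esub> (mon_poly ` (G - {g})) :: 'k mpoly set"
    have sub: "mon_poly ` (G - {g}) \<subseteq> (carrier (poly_ring n) :: 'k mpoly set)"
      using Gm by (intro carr) auto
    interpret J: ideal ?J "poly_ring n" by (rule R.genideal_ideal[OF sub])
    have "(mon_poly (v + u) :: 'k mpoly) \<in> carrier (poly_ring n)"
      using monomials_add[OF g'(2) h(2)] by (simp add: poly_ring_def mon_poly_def)
    moreover have "mon_poly g' \<in> ?J"
      using R.genideal_self[OF sub] g' ne by blast
    ultimately have "mon_poly g' \<otimes>\<^bsub>poly_ring n\<^esub> mon_poly (v + u) \<in> ?J"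
      by (intro J.I_r_closed)
    then have "mon_poly g \<in> ?J"
      using h g' by (simp add: poly_ring_def mon_poly_def mult_single add.assoc)
    then have "mon_poly ` G \<subseteq> ?J"
      using R.genideal_self[OF sub] by blast
    then have "I \<subseteq> ?J"
      using R.genideal_minimal[OF J.ideal_axioms] IG by blast
    moreover have "?J \<subseteq> I"
      using R.Idl_subset_ideal[OF R.genideal_ideal[OF carr[OF Gm]] sub]
        R.genideal_self[OF carr[OF Gm]] IG by blast
    ultimately show False
      using G g unfolding minimal_monomial_generating_set_def by blast
  qed
  then have "h + u = h + u + (v + u)"
    using h g' by (simp add: algebra_simps)
  then have "v + u = 0" by (metis add_cancel_left_right)
  then have "Poly_Mapping.lookup v i + Poly_Mapping.lookup u i = 0" for i
    by (metis Poly_Mapping.lookup_add Poly_Mapping.lookup_zero)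
  then have "u = 0" by (intro poly_mapping_eqI) auto
  then show "g \<in> H" using h by simp
qed

lemma ex1_GEN_stanley_reisner_ideal:
  "\<exists>!G. minimal_monomial_generating_set n (stanley_reisner_ideal n \<Gamma> :: 'k::field mpoly set) G"
proof -
  let ?I = "stanley_reisner_ideal n \<Gamma> :: 'k mpoly set"
  define A where "A = squarefree_mon ` {F. F \<subseteq> {1..n} \<and> F \<notin> \<Gamma>}"
  define gen where
    "gen = (\<lambda>B. B \<subseteq> monomials n \<and> Idl\<^bsub>poly_ring n\<^esub> (mon_poly ` B) = ?I)"
  have "squarefree_mon F \<in> monomials n" if "F \<subseteq> {1..n}" for F
  proof -
    have "finite F" using that finite_subset by blast
    then have "Poly_Mapping.keys (squarefree_mon F) \<subseteq> F"
      unfolding squarefree_mon_def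
    proof (induction F)
      case (insert x F)
      then show ?case
        using Poly_Mapping.keys_add[of "Poly_Mapping.single x 1" "\<Sum>i\<in>F. Poly_Mapping.single i (1::nat)"]
        by auto
    qed simp
    then show ?thesis using that by (auto simp: monomials_def)
  qed
  then have "gen A"
    by (auto simp: gen_def A_def stanley_reisner_ideal_def image_image setcompr_eq_image)
  moreover have "finite A" by (simp add: A_def)
  ultimately have fin: "finite {B. B \<subseteq> A \<and> gen B}" and ne: "{B. B \<subseteq> A \<and> gen B} \<noteq> {}" by auto
  obtain G where G: "G \<in> {B. B \<subseteq> A \<and> gen B}"
    and min: "\<forall>B\<in>{B. B \<subseteq> A \<and> gen B}. B \<le> G \<longrightarrow> G = B"
    using finite_has_minimal[OF fin ne] by (elim bexE)
  have "minimal_monomial_generating_set n ?I G"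
    unfolding minimal_monomial_generating_set_def
  proof (intro conjI allI impI notI)
    fix H assume H: "H \<subset> G" "Idl\<^bsub>poly_ring n\<^esub> (mon_poly ` H) = ?I"
    then have "H \<in> {B. B \<subseteq> A \<and> gen B}"
      using G by (auto simp: gen_def)
    then show False using min H(1) by auto
  qed (use G in \<open>auto simp: gen_def\<close>)
  then show ?thesis
    by (intro ex1I[of _ G] equalityI) (assumption | erule (1) minimal_monomial_generating_set_subset)+
qed

text \<open>A monomial ideal has exactly one minimal monomial generating set, namely its
  divisibility-minimal monomials; on other ideals the following is unspecified.\<close>

definition GEN :: "nat \<Rightarrow> 'k::field mpoly set \<Rightarrow> mon set" where
  "GEN n I = (THE G. minimal_monomial_generating_set n I G)"

definition mon_deg :: "mon \<Rightarrow> nat" where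
  "mon_deg m = (\<Sum>i\<in>Poly_Mapping.keys m. Poly_Mapping.lookup m i)"

text \<open>The least common multiple of a finite set of monomials, by taking the maximum of each
  exponent; inserting \<open>0\<close> makes the empty set have least common multiple \<open>1\<close>.\<close>

definition mon_lcm :: "mon set \<Rightarrow> mon" where
  "mon_lcm T = Poly_Mapping.Abs_poly_mapping
     (\<lambda>i. Max (insert 0 ((\<lambda>m. Poly_Mapping.lookup m i) ` T)))"

lemma lookup_mon_lcm:
  assumes "finite T"
  shows "Poly_Mapping.lookup (mon_lcm T) i =
    Max (insert 0 ((\<lambda>m. Poly_Mapping.lookup m i) ` T))"
proof -
  let ?f = "\<lambda>i. Max (insert 0 ((\<lambda>m. Poly_Mapping.lookup m i) ` T))"
  have "{i. ?f i \<noteq> 0} \<subseteq> (\<Union>m\<in>T. Poly_Mapping.keys m)"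
  proof
    fix i assume "i \<in> {i. ?f i \<noteq> 0}"
    moreover have "?f i \<in> insert 0 ((\<lambda>m. Poly_Mapping.lookup m i) ` T)"
      using assms by (intro Max_in) auto
    ultimately show "i \<in> (\<Union>m\<in>T. Poly_Mapping.keys m)"
      by (auto simp: Poly_Mapping.in_keys_iff)
  qed
  then have "finite {i. ?f i \<noteq> 0}"
    by (rule finite_subset) (use assms in auto)
  then show ?thesis
    by (simp add: mon_lcm_def)
qed

text \<open>The maximum is over a finite set, which is nonempty iff \<open>i\<close> is at most the number of
  minimal generators.\<close>

definition taylor_max_shift :: "nat \<Rightarrow> 'k::field mpoly set \<Rightarrow> nat \<Rightarrow> nat" where
  "taylor_max_shift n I i = Max {mon_deg (mon_lcm T) | T. T \<subseteq> GEN n I \<and> card T = i}"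

end

theory Submission
  imports Defs
begin

text \<open>
  Let \<open>c = n - d\<close>, so that the hypothesis reads \<open>8 * d + 1 \<le> c\<close>. The left-hand side counts some of the
  \<open>d\<close>-subsets of \<open>{1..n}\<close>, hence is at most \<open>n choose d\<close>, which is \<open>1 / c!\<close> times the product of the
  \<open>d + i\<close> over \<open>1 \<le> i \<le> c\<close>. It is therefore enough to bound the product of the Taylor shifts from
  below by a number exceeding \<open>(d + 1) \<cdots> (d + c)\<close>.

  The minimal generators are the squarefree monomials of the minimal nonfaces, and the degree of
  the lcm of a set of them is the size of the union of the corresponding nonfaces. Since more than
  \<open>d\<close> vertices never form a face, as long as a union of minimal nonfaces leaves more than \<open>d\<close>
  vertices uncovered there is another minimal nonface disjoint from it; it has at least two
  elements because all vertices are faces. Choosing greedily, the \<open>i\<close>-th shift is at least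
  \<open>min (2 * i) c\<close> (\<open>exists_nonfaces_with_large_union\<close>). There are at least \<open>c\<close> minimal nonfaces, so
  the choice can go on up to \<open>i = c\<close>: one vertex from each of them gives a set meeting all of them,
  whose complement is a face and so has at most \<open>d\<close> vertices (\<open>card_minimal_nonfaces\<close>).

  What is left is that the product of the \<open>min (2 * i) c\<close> exceeds that of the \<open>d + i\<close> when
  \<open>1 \<le> d\<close> and \<open>8 * d \<le> c\<close> (\<open>prod_min_eq_capped_even_prod\<close>,
  \<open>fact_quotient_less_capped_even_prod\<close>); and \<open>1 \<le> d\<close> because there is a vertex. For \<open>c = 8 * d\<close>,
  Stirling's formula shows the quotient to grow like \<open>(8^8 * exp 4 / 9^9)^d\<close>, up to a factor of
  order \<open>sqrt d\<close>, and the base is about \<open>2.36\<close>; the elementary proof is an induction on \<open>d\<close> along \<open>c = 8 * d\<close>, followed by an induction on \<open>c\<close> for fixed \<open>d\<close>.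
\<close>

section \<open>The product inequality\<close>

text \<open>A closed form of the product of \<open>min (2 * i) c\<close> over \<open>1 \<le> i \<le> c\<close>, in which the effect of
  changing the cap \<open>c\<close> is visible.\<close>

definition capped_even_prod :: "nat \<Rightarrow> real" where
  "capped_even_prod c = (\<Prod>i=1..c div 2. 2 * real i) * real c ^ (c - c div 2)"

lemma prod_min_eq_capped_even_prod:
  "(\<Prod>i=1..c. real (min (2 * i) c)) = capped_even_prod c"
proof -
  have split: "{1..c} = {1..c div 2} \<union> {c div 2 + 1..c}" by auto
  have "(\<Prod>i=1..c. real (min (2 * i) c)) =
      (\<Prod>i=1..c div 2. real (min (2 * i) c)) * (\<Prod>i=c div 2 + 1..c. real (min (2 * i) c))"
    unfolding split by (rule prod.union_disjoint) auto
  also have "(\<Prod>i=1..c div 2. real (min (2 * i) c)) = (\<Prod>i=1..c div 2. 2 * real i)"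
    by (rule prod.cong) auto
  also have "(\<Prod>i=c div 2 + 1..c. real (min (2 * i) c)) = (\<Prod>i=c div 2 + 1..c. real c)"
    by (rule prod.cong) auto
  finally show ?thesis by (simp add: capped_even_prod_def)
qed

lemma capped_even_prod_pos: "0 < c \<Longrightarrow> 0 < capped_even_prod c"
  unfolding capped_even_prod_def by (intro mult_pos_pos prod_pos) auto

text \<open>Raising the cap from \<open>c\<close> to \<open>c + 1\<close> multiplies at least \<open>c / 2\<close> old factors by \<open>1 + 1 / c\<close>, which
  by Bernoulli's inequality gains at least \<open>3 / 2\<close>, and there is one new factor \<open>c + 1\<close>.\<close>

lemma capped_even_prod_Suc:
  assumes "0 < c"
  shows "3 / 2 * (real c + 1) * capped_even_prod c \<le> capped_even_prod (Suc c)"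
proof -
  let ?m = "c - c div 2"
  let ?P = "\<Prod>i=1..c div 2. 2 * real i"
  have step: "capped_even_prod (Suc c) = ?P * (real c + 1) ^ Suc ?m"
  proof (cases "even c")
    case True
    then show ?thesis by (simp add: capped_even_prod_def Suc_diff_le add.commute)
  next
    case False
    then obtain k where k: "c = 2 * k + 1" by (elim oddE)
    then show ?thesis by (simp add: capped_even_prod_def algebra_simps)
  qed
  have P: "0 \<le> ?P" by (intro prod_nonneg) auto
  have "3 / 2 \<le> 1 + real ?m * (1 / real c)"
    using assms by (simp add: field_simps)
  also have "\<dots> \<le> (1 + 1 / real c) ^ ?m"
    by (rule Bernoulli_inequality) (simp add: order_trans[of _ 0])
  finally have "3 / 2 * real c ^ ?m \<le> (1 + 1 / real c) ^ ?m * real c ^ ?m"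
    by (intro mult_right_mono) auto
  also have "\<dots> = (real c + 1) ^ ?m"
    using assms by (simp add: power_mult_distrib[symmetric] field_simps)
  finally have "?P * (real c + 1) * (3 / 2 * real c ^ ?m) \<le> ?P * (real c + 1) * (real c + 1) ^ ?m"
    using P by (intro mult_left_mono) auto
  then have "3 / 2 * (real c + 1) * (?P * real c ^ ?m) \<le> ?P * ((real c + 1) * (real c + 1) ^ ?m)"
    by (simp only: mult_ac)
  then show ?thesis unfolding step by (simp only: capped_even_prod_def power_Suc)
qed

lemma one_plus_power_ge_quadratic:
  fixes x :: real
  assumes "0 \<le> x"
  shows "1 + real k * x + real k * (real k - 1) / 2 * x^2 \<le> (1 + x) ^ k"
proof (induction k)
  case (Suc k)
  have "1 + real (Suc k) * x + real (Suc k) * (real (Suc k) - 1) / 2 * x^2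
      \<le> (1 + x) * (1 + real k * x + real k * (real k - 1) / 2 * x^2)"
  proof -
    have "0 \<le> real k * (real k - 1) / 2 * x^3"
      using assms by (cases k) auto
    then show ?thesis by (simp add: field_simps power2_eq_square power3_eq_cube)
  qed
  also have "\<dots> \<le> (1 + x) * (1 + x) ^ k"
    using Suc assms by (intro mult_left_mono) auto
  finally show ?case by simp
qed simp

text \<open>When \<open>d\<close> becomes \<open>d + 1\<close> and \<open>c = 8 * d\<close> becomes \<open>8 * d + 8\<close>, the product of the \<open>d + i\<close> is
  multiplied by \<open>9 * (9 * d + 1) \<cdots> (9 * d + 8)\<close>, and the product of the \<open>min (2 * i) c\<close> by
  \<open>(8 * d + 2) * (8 * d + 4) * (8 * d + 6) * (8 * d + 8)^5\<close> times \<open>(1 + 1 / d)^(4 * d)\<close>. The last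
  power must not be estimated too crudely: for large \<open>d\<close> it has to be at least \<open>9^9 / 8^8\<close>, about
  \<open>23.1\<close>, while Bernoulli's inequality only gives \<open>2^4\<close>. The quadratic term of the binomial
  expansion improves this to \<open>((5 * d - 1) / (2 * d))^4\<close>, which tends to \<open>(5 / 2)^4\<close>, about \<open>39.1\<close>.
  The following inequality, with denominators cleared, says that this is enough.\<close>

lemma step_polynomial_le:
  fixes x :: real
  assumes "1 \<le> x"
  shows "9 * ((9*x+1) * (9*x+2) * (9*x+3) * (9*x+4) * (9*x+5) * (9*x+6) * (9*x+7) * (9*x+8))
    * (2*x)^4 \<le> (8*x+2) * (8*x+4) * (8*x+6) * (8*x+8) * (8*x+8)^4 * (5*x-1)^4"
proof -
  \<comment> \<open>In the variable \<open>x - 1\<close>, all coefficients of the difference are nonnegative.\<close>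
  obtain y where y: "x = y + 1" "0 \<le> y"
    using assms by (intro that[of "x - 1"]) auto
  have p: "0 \<le> y ^ k" for k using y by simp
  show ?thesis
    unfolding y(1) power4_eq_xxxx
    using y(2) p[of 2] p[of 3] p[of 4] p[of 5] p[of 6] p[of 7] p[of 8] p[of 9] p[of 10] p[of 11] p[of 12]
    by (simp add: algebra_simps power_numeral_reduce)
qed

lemma one_plus_inverse_power_ge:
  assumes "1 \<le> d"
  shows "((5 * real d - 1) / (2 * real d)) ^ 4 \<le> (1 + 1 / real d) ^ (4 * d)"
proof -
  have "(5 * real d - 1) / (2 * real d)
      = 1 + real d * (1 / real d) + real d * (real d - 1) / 2 * (1 / real d)^2"
    using assms by (simp add: field_simps power2_eq_square)
  also have "\<dots> \<le> (1 + 1 / real d) ^ d"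
    by (rule one_plus_power_ge_quadratic) simp
  finally have "((5 * real d - 1) / (2 * real d)) ^ 4 \<le> ((1 + 1 / real d) ^ d) ^ 4"
    using assms by (intro power_mono) auto
  then show ?thesis by (simp add: power_mult[symmetric] mult.commute)
qed

lemma fact_quotient_less_capped_even_prod_diagonal:
  assumes "1 \<le> d"
  shows "fact (9 * d) / fact d < capped_even_prod (8 * d)"
  using assms
proof (induction d rule: dec_induct)
  case base
  have "{1..4::nat} = {1, 2, 3, 4}" by auto
  then show ?case by (simp add: capped_even_prod_def fact_numeral)
next
  case (step d)
  define x where "x = real d"
  have x: "1 \<le> x" using step by (simp add: x_def)
  let ?A = "(9*x+1) * (9*x+2) * (9*x+3) * (9*x+4) * (9*x+5) * (9*x+6) * (9*x+7) * (9*x+8)"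
  let ?B = "(8*x+2) * (8*x+4) * (8*x+6) * (8*x+8) * (8*x+8)^4"
  let ?P = "\<Prod>i=1..4*d. 2 * real i"
  have A: "0 < ?A" and B: "0 < ?B" using x by (auto intro!: mult_pos_pos)
  have "fact (9 * Suc d) = fact (9 * d) * ?A * (9 * (x + 1))"
    by (simp add: x_def numeral_eq_Suc algebra_simps)
  moreover have "(fact (Suc d) :: real) = (x + 1) * fact d"
    by (simp add: x_def algebra_simps)
  ultimately have lhs: "fact (9 * Suc d) / fact (Suc d) = (fact (9 * d) / fact d) * (9 * ?A)"
    using x by (simp add: divide_simps)
  have "capped_even_prod (8 * Suc d) = ?P * ?B * (8*x+8) ^ (4*d)"
  proof -
    have half: "4 * Suc d = Suc (Suc (Suc (Suc (4 * d))))" by simp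
    have "(\<Prod>i=1..4 * Suc d. 2 * real i) = ?P * ((8*x+2) * (8*x+4) * (8*x+6) * (8*x+8))"
      unfolding half by (simp add: x_def algebra_simps)
    moreover have "real (8 * Suc d) = 8*x+8" by (simp add: x_def)
    moreover have "8 * Suc d - 8 * Suc d div 2 = 4 + 4*d" by simp
    moreover have "8 * Suc d div 2 = 4 * Suc d" by simp
    ultimately show ?thesis by (simp only: capped_even_prod_def power_add mult_ac)
  qed
  also have "(8*x+8) ^ (4*d) = (8*x) ^ (4*d) * (1 + 1 / x) ^ (4*d)"
  proof -
    have "8*x+8 = 8*x * (1 + 1 / x)" using x by (simp add: field_simps)
    then show ?thesis by (simp only: power_mult_distrib)
  qed
  finally have rhs: "capped_even_prod (8 * Suc d) =
      capped_even_prod (8 * d) * (?B * (1 + 1 / x) ^ (4*d))"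
    by (simp add: capped_even_prod_def x_def mult_ac)
  have "9 * ?A \<le> ?B * ((5*x-1) / (2*x)) ^ 4"
    using step_polynomial_le[OF x] x by (simp add: power_divide pos_le_divide_eq)
  also have "\<dots> \<le> ?B * (1 + 1 / x) ^ (4*d)"
    using B one_plus_inverse_power_ge[OF step(1)] unfolding x_def
    by (intro mult_left_mono) auto
  finally have "9 * ?A \<le> ?B * (1 + 1 / x) ^ (4*d)" .
  then show ?case
    unfolding lhs rhs using step A
    by (intro mult_less_le_imp_less) auto
qed

text \<open>Here \<open>fact (c + d) / fact d\<close> is the product of the \<open>d + i\<close> over \<open>1 \<le> i \<le> c\<close>. From the
  diagonal \<open>c = 8 * d\<close> the inequality spreads to larger \<open>c\<close>: as \<open>d \<le> c / 2\<close>, the factor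
  \<open>c + 1 + d\<close> gained on the left is at most the factor \<open>3 / 2 * (c + 1)\<close> gained on the right.\<close>

lemma fact_quotient_less_capped_even_prod:
  assumes "1 \<le> d" "8 * d \<le> c"
  shows "fact (c + d) / fact d < capped_even_prod c"
  using assms(2)
proof (induction c rule: dec_induct)
  case base
  show ?case using fact_quotient_less_capped_even_prod_diagonal[OF assms(1)] by simp
next
  case (step c)
  have "fact (Suc c + d) / fact d = (real c + 1 + real d) * (fact (c + d) / fact d)"
    by (simp add: algebra_simps)
  also have "\<dots> < (real c + 1 + real d) * capped_even_prod c"
    using step by (intro mult_strict_left_mono) auto
  also have "\<dots> \<le> 3 / 2 * (real c + 1) * capped_even_prod c"
    using step assms(1) capped_even_prod_pos[of c] by (intro mult_right_mono) auto
  also have "\<dots> \<le> capped_even_prod (Suc c)"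
    using step assms(1) by (intro capped_even_prod_Suc) auto
  finally show ?case .
qed

section \<open>Minimal nonfaces\<close>

definition minimal_nonfaces :: "nat \<Rightarrow> nat set set \<Rightarrow> nat set set" where
  "minimal_nonfaces n \<Gamma> = {F. F \<subseteq> {1..n} \<and> F \<notin> \<Gamma> \<and> (\<forall>G. G \<subset> F \<longrightarrow> G \<in> \<Gamma>)}"

lemma finite_minimal_nonfaces: "finite (minimal_nonfaces n \<Gamma>)"
  by (rule finite_subset[of _ "Pow {1..n}"]) (auto simp: minimal_nonfaces_def)

lemma finite_minimal_nonface: "F \<in> minimal_nonfaces n \<Gamma> \<Longrightarrow> finite F"
  by (auto simp: minimal_nonfaces_def intro: finite_subset)

lemma exists_minimal_nonface_subset:
  assumes "F \<subseteq> {1..n}" "F \<notin> \<Gamma>"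
  shows "\<exists>N\<in>minimal_nonfaces n \<Gamma>. N \<subseteq> F"
proof -
  have "finite {N. N \<subseteq> F \<and> N \<notin> \<Gamma>}"
    by (rule finite_subset[of _ "Pow F"]) (use assms finite_subset in auto)
  moreover have "F \<in> {N. N \<subseteq> F \<and> N \<notin> \<Gamma>}" using assms by simp
  ultimately obtain N where "N \<in> {N. N \<subseteq> F \<and> N \<notin> \<Gamma>}" "N \<subseteq> F"
      "\<forall>G\<in>{N. N \<subseteq> F \<and> N \<notin> \<Gamma>}. G \<subseteq> N \<longrightarrow> N = G"
    by (elim finite_has_minimal2[elim_format] bexE) auto
  then have "N \<in> minimal_nonfaces n \<Gamma>"
    using assms unfolding minimal_nonfaces_def by blast
  then show ?thesis using \<open>N \<subseteq> F\<close> by blast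
qed

lemma minimal_nonfaces_antichain:
  assumes "M \<in> minimal_nonfaces n \<Gamma>" "N \<in> minimal_nonfaces n \<Gamma>" "M \<subseteq> N"
  shows "M = N"
  using assms unfolding minimal_nonfaces_def by blast

lemma card_minimal_nonface_ge_2:
  assumes "simplicial_complex_on n \<Gamma>" "\<Gamma> \<noteq> {}" "N \<in> minimal_nonfaces n \<Gamma>"
  shows "2 \<le> card N"
proof (rule ccontr)
  assume "\<not> 2 \<le> card N"
  moreover have "finite N" using assms(3) by (rule finite_minimal_nonface)
  ultimately consider "N = {}" | v where "N = {v}"
    by (metis card_0_eq card_1_singletonE less_2_cases not_le One_nat_def)
  then have "N \<in> \<Gamma>"
  proof cases
    case 1
    then show ?thesis using assms unfolding simplicial_complex_on_def by blast
  next
    case 2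
    then show ?thesis using assms unfolding simplicial_complex_on_def minimal_nonfaces_def by auto
  qed
  then show False using assms(3) by (simp add: minimal_nonfaces_def)
qed

text \<open>Removing a transversal of the minimal nonfaces leaves a face, and there is a transversal with
  at most one vertex for each minimal nonface.\<close>

lemma card_minimal_nonfaces:
  assumes faces: "\<And>F. F \<in> \<Gamma> \<Longrightarrow> card F \<le> d" and "{} \<in> \<Gamma>"
  shows "n - d \<le> card (minimal_nonfaces n \<Gamma>)"
proof -
  let ?T = "(\<lambda>N. SOME v. v \<in> N) ` minimal_nonfaces n \<Gamma>"
  have pick: "(SOME v. v \<in> N) \<in> N" if "N \<in> minimal_nonfaces n \<Gamma>" for N
  proof -
    have "N \<noteq> {}" using that \<open>{} \<in> \<Gamma>\<close> unfolding minimal_nonfaces_def by blast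
    then show ?thesis by (simp add: some_in_eq)
  qed
  have "{1..n} - ?T \<in> \<Gamma>"
  proof (rule ccontr)
    assume "{1..n} - ?T \<notin> \<Gamma>"
    then obtain N where "N \<in> minimal_nonfaces n \<Gamma>" "N \<subseteq> {1..n} - ?T"
      using exists_minimal_nonface_subset[of "{1..n} - ?T"] by blast
    then show False using pick by blast
  qed
  then have "card ({1..n} - ?T) \<le> d" by (rule faces)
  moreover have "card {1..n} - card ?T \<le> card ({1..n} - ?T)"
    by (rule diff_card_le_card_Diff) (simp add: finite_minimal_nonfaces)
  moreover have "card ?T \<le> card (minimal_nonfaces n \<Gamma>)"
    by (rule card_image_le[OF finite_minimal_nonfaces])
  ultimately show ?thesis by simp
qed

text \<open>While more than \<open>d\<close> vertices are uncovered, a minimal nonface among them enlarges the union by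
  at least two. As soon as at most \<open>d\<close> are uncovered, the union has reached size \<open>n - d\<close>, and any
  further minimal nonfaces may be added.\<close>

lemma exists_nonfaces_with_large_union:
  assumes complex: "simplicial_complex_on n \<Gamma>" "\<Gamma> \<noteq> {}"
    and faces: "\<And>F. F \<in> \<Gamma> \<Longrightarrow> card F \<le> d"
    and "i \<le> n - d"
  shows "\<exists>S\<subseteq>minimal_nonfaces n \<Gamma>. card S = i \<and> min (2 * i) (n - d) \<le> card (\<Union>S)"
  using \<open>i \<le> n - d\<close>
proof (induction i)
  case (Suc i)
  then obtain S where S: "S \<subseteq> minimal_nonfaces n \<Gamma>" "card S = i"
    "min (2 * i) (n - d) \<le> card (\<Union>S)" by auto
  have "finite S" using S(1) finite_minimal_nonfaces finite_subset by blast
  have US: "\<Union>S \<subseteq> {1..n}" using S(1) by (auto simp: minimal_nonfaces_def)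
  then have "finite (\<Union>S)" using finite_subset by blast
  obtain N where N: "N \<in> minimal_nonfaces n \<Gamma>" "N \<notin> S"
    and large: "min (2 * Suc i) (n - d) \<le> card (N \<union> \<Union>S)"
  proof (cases "n - d \<le> card (\<Union>S)")
    case True
    have "{} \<in> \<Gamma>" using complex unfolding simplicial_complex_on_def by blast
    then have "n - d \<le> card (minimal_nonfaces n \<Gamma>)"
      using faces by (intro card_minimal_nonfaces) auto
    then have "S \<noteq> minimal_nonfaces n \<Gamma>" using Suc.prems S(2) by auto
    then obtain N where N: "N \<in> minimal_nonfaces n \<Gamma>" "N \<notin> S" using S(1) by blast
    have "card (\<Union>S) \<le> card (N \<union> \<Union>S)"
      using \<open>finite (\<Union>S)\<close> finite_minimal_nonface[OF N(1)] by (intro card_mono) auto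
    then show ?thesis using True by (intro that[OF N]) auto
  next
    case False
    have "card ({1..n} - \<Union>S) = n - card (\<Union>S)"
      using US \<open>finite (\<Union>S)\<close> by (simp add: card_Diff_subset)
    then have "{1..n} - \<Union>S \<notin> \<Gamma>" using False faces by fastforce
    then obtain N where N: "N \<in> minimal_nonfaces n \<Gamma>" "N \<subseteq> {1..n} - \<Union>S"
      using exists_minimal_nonface_subset[of "{1..n} - \<Union>S"] by blast
    have "2 \<le> card N" by (rule card_minimal_nonface_ge_2[OF complex N(1)])
    then have "N \<noteq> {}" by auto
    have disj: "N \<inter> \<Union>S = {}" using N(2) by blast
    then have "N \<notin> S" using \<open>N \<noteq> {}\<close> by blast
    have "card (N \<union> \<Union>S) = card N + card (\<Union>S)"
      using finite_minimal_nonface[OF N(1)] \<open>finite (\<Union>S)\<close> disj by (rule card_Un_disjoint)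
    then show ?thesis using S(3) \<open>2 \<le> card N\<close> \<open>N \<notin> S\<close> by (intro that[OF N(1)]) auto
  qed
  show ?case
    using S N large \<open>finite S\<close> by (intro exI[of _ "insert N S"]) auto
qed auto

section \<open>Squarefree monomials and the Taylor shifts\<close>

lemma lookup_squarefree_mon:
  assumes "finite F"
  shows "Poly_Mapping.lookup (squarefree_mon F) i = (if i \<in> F then 1 else 0)"
  using assms unfolding squarefree_mon_def
  by (induction F) (auto simp: lookup_add lookup_single when_def)

lemma keys_squarefree_mon: "finite F \<Longrightarrow> Poly_Mapping.keys (squarefree_mon F) = F"
  by (auto simp: in_keys_iff lookup_squarefree_mon split: if_splits)

lemma squarefree_mon_in_monomials: "F \<subseteq> {1..n} \<Longrightarrow> squarefree_mon F \<in> monomials n"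
  by (simp add: monomials_def keys_squarefree_mon finite_subset)

lemma mon_poly_in_carrier:
  "G \<subseteq> monomials n \<Longrightarrow> mon_poly ` G \<subseteq> (carrier (poly_ring n) :: 'k::field mpoly set)"
  by (auto simp: poly_ring_def mon_poly_def)

lemma squarefree_mon_subset_split:
  assumes "finite F" "N \<subseteq> F"
  shows "squarefree_mon F = squarefree_mon N + squarefree_mon (F - N)"
  using assms finite_subset[OF assms(2,1)]
  by (intro poly_mapping_eqI) (auto simp: lookup_add lookup_squarefree_mon)

lemma mon_deg_lcm_squarefree:
  assumes "finite S" "\<And>F. F \<in> S \<Longrightarrow> finite F"
  shows "mon_deg (mon_lcm (squarefree_mon ` S)) = card (\<Union>S)"
proof -
  have *: "Poly_Mapping.lookup (mon_lcm (squarefree_mon ` S)) i = (if i \<in> \<Union>S then 1 else 0)" for i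
  proof -
    let ?A = "insert 0 ((\<lambda>m. Poly_Mapping.lookup m i) ` squarefree_mon ` S)"
    have A: "?A = (if i \<in> \<Union>S then {0, 1} else {0})"
      using assms by (auto simp: lookup_squarefree_mon image_iff split: if_splits)
    have "Poly_Mapping.lookup (mon_lcm (squarefree_mon ` S)) i = Max ?A"
      using assms(1) by (intro lookup_mon_lcm) simp
    then show ?thesis unfolding A by simp
  qed
  then have "Poly_Mapping.keys (mon_lcm (squarefree_mon ` S)) = \<Union>S"
    by (auto simp: in_keys_iff split: if_splits)
  then show ?thesis unfolding mon_deg_def by (simp add: *)
qed

text \<open>The squarefree monomial of a nonface is divisible by that of a minimal nonface contained in it,
  so the latter generate. None of them can be omitted, since a monomial in a monomial ideal is
  divisible by a generator and minimal nonfaces form an antichain.\<close>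

lemma GEN_stanley_reisner_ideal:
  "GEN n (stanley_reisner_ideal n \<Gamma> :: 'k::field mpoly set) =
    squarefree_mon ` minimal_nonfaces n \<Gamma>"
proof -
  let ?I = "stanley_reisner_ideal n \<Gamma> :: 'k mpoly set"
  let ?G = "squarefree_mon ` minimal_nonfaces n \<Gamma>"
  let ?A = "squarefree_mon ` {F. F \<subseteq> {1..n} \<and> F \<notin> \<Gamma>}"
  interpret R: cring "poly_ring n :: 'k mpoly ring" by (rule cring_poly_ring)
  have Am: "?A \<subseteq> monomials n" using squarefree_mon_in_monomials by blast
  have GA: "?G \<subseteq> ?A" by (auto simp: minimal_nonfaces_def)
  have Gm: "?G \<subseteq> monomials n" using GA Am by blast
  have I: "?I = Idl\<^bsub>poly_ring n\<^esub> (mon_poly ` ?A)"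
    by (simp add: stanley_reisner_ideal_def image_image setcompr_eq_image)
  let ?J = "Idl\<^bsub>poly_ring n\<^esub> (mon_poly ` ?G) :: 'k mpoly set"
  interpret J: ideal ?J "poly_ring n" by (rule R.genideal_ideal[OF mon_poly_in_carrier[OF Gm]])
  have "(mon_poly (squarefree_mon F) :: 'k mpoly) \<in> ?J" if F: "F \<subseteq> {1..n}" "F \<notin> \<Gamma>" for F
  proof -
    obtain N where N: "N \<in> minimal_nonfaces n \<Gamma>" "N \<subseteq> F"
      using exists_minimal_nonface_subset[OF F] by blast
    have "(mon_poly (squarefree_mon (F - N)) :: 'k mpoly) \<in> carrier (poly_ring n)"
      using F mon_poly_in_carrier[of "{squarefree_mon (F - N)}" n]
        squarefree_mon_in_monomials[of "F - N" n] by auto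
    moreover have "mon_poly (squarefree_mon N) \<in> ?J"
      using R.genideal_self[OF mon_poly_in_carrier[OF Gm]] N by blast
    ultimately have
      "mon_poly (squarefree_mon N) \<otimes>\<^bsub>poly_ring n\<^esub> mon_poly (squarefree_mon (F - N)) \<in> ?J"
      by (intro J.I_r_closed)
    then show ?thesis
      using squarefree_mon_subset_split[OF finite_subset[OF F(1)] N(2)]
      by (simp add: poly_ring_def mon_poly_def mult_single)
  qed
  then have "?I \<subseteq> ?J"
    unfolding I by (intro R.genideal_minimal[OF J.ideal_axioms]) auto
  moreover have "?J \<subseteq> ?I"
    unfolding I using R.genideal_self[OF mon_poly_in_carrier[OF Am]]
    by (intro R.genideal_minimal[OF R.genideal_ideal[OF mon_poly_in_carrier[OF Am]]]
        subset_trans[OF image_mono[OF GA]])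
  ultimately have gen: "?J = ?I" by blast
  have "minimal_monomial_generating_set n ?I ?G"
    unfolding minimal_monomial_generating_set_def
  proof (intro conjI allI impI notI)
    fix H assume H: "H \<subset> ?G" "Idl\<^bsub>poly_ring n\<^esub> (mon_poly ` H) = ?I"
    then obtain N where N: "N \<in> minimal_nonfaces n \<Gamma>" "squarefree_mon N \<notin> H" by blast
    have "(mon_poly (squarefree_mon N) :: 'k mpoly) \<in> Idl\<^bsub>poly_ring n\<^esub> (mon_poly ` H)"
      using R.genideal_self[OF mon_poly_in_carrier[OF Gm]] N gen H(2) by blast
    then have "\<exists>g\<in>H. \<exists>h\<in>monomials n. squarefree_mon N = g + h"
      using H(1) Gm by (intro genideal_monomials_dvd) (auto simp: mon_poly_def)
    then obtain M h where M: "M \<in> minimal_nonfaces n \<Gamma>" "squarefree_mon M \<in> H"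
      and eq: "squarefree_mon N = squarefree_mon M + h" using H(1) by blast
    \<comment> \<open>Divisibility of squarefree monomials is inclusion of their supports.\<close>
    have "M \<subseteq> N"
    proof
      fix v assume "v \<in> M"
      then have "Poly_Mapping.lookup (squarefree_mon N) v \<noteq> 0"
        unfolding eq using finite_minimal_nonface[OF M(1)]
        by (simp add: lookup_add lookup_squarefree_mon)
      then show "v \<in> N"
        using finite_minimal_nonface[OF N(1)] by (simp add: lookup_squarefree_mon split: if_splits)
    qed
    then have "M = N" by (rule minimal_nonfaces_antichain[OF M(1) N(1)])
    then show False using M N by blast
  qed (use Gm gen in auto)
  then show ?thesis
    unfolding GEN_def by (rule the1_equality[OF ex1_GEN_stanley_reisner_ideal])
qed

lemma card_Union_le_taylor_max_shift:
  assumes "S \<subseteq> minimal_nonfaces n \<Gamma>"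
  shows "card (\<Union>S) \<le>
    taylor_max_shift n (stanley_reisner_ideal n \<Gamma> :: 'k::field mpoly set) (card S)"
proof -
  let ?G = "GEN n (stanley_reisner_ideal n \<Gamma> :: 'k mpoly set)"
  let ?D = "{mon_deg (mon_lcm T) | T. T \<subseteq> ?G \<and> card T = card S}"
  have G: "?G = squarefree_mon ` minimal_nonfaces n \<Gamma>" by (rule GEN_stanley_reisner_ideal)
  have "finite ?G" unfolding G using finite_minimal_nonfaces by simp
  then have "finite ?D"
    by (intro finite_subset[of ?D "(\<lambda>T. mon_deg (mon_lcm T)) ` Pow ?G"]) auto
  moreover have "card (\<Union>S) \<in> ?D"
  proof -
    have fin: "finite F" if "F \<in> S" for F
      using that assms finite_minimal_nonface by blast
    have "inj_on squarefree_mon S"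
      using fin keys_squarefree_mon by (metis inj_onI)
    then have "card (squarefree_mon ` S) = card S" by (rule card_image)
    moreover have "squarefree_mon ` S \<subseteq> ?G" using assms unfolding G by blast
    moreover have "card (\<Union>S) = mon_deg (mon_lcm (squarefree_mon ` S))"
      using fin finite_subset[OF assms finite_minimal_nonfaces]
      by (intro mon_deg_lcm_squarefree[symmetric]) auto
    ultimately show ?thesis by blast
  qed
  ultimately show ?thesis unfolding taylor_max_shift_def by (rule Max_ge)
qed

section \<open>The Taylor upper bound\<close>

lemma face_number_le_choose:
  assumes "simplicial_complex_on n \<Gamma>"
  shows "face_number (int d - 1) \<Gamma> \<le> n choose d"
proof -
  have "face_number (int d - 1) \<Gamma> \<le> card {F. F \<subseteq> {1..n} \<and> card F = d}"
    unfolding face_number_def using assms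
    by (intro card_mono) (auto simp: simplicial_complex_on_def face_dim_def)
  also have "\<dots> = n choose d" by (simp add: n_subsets)
  finally show ?thesis .
qed

theorem theorem5p4:
  fixes n d :: nat and \<Gamma> :: "nat set set"
  assumes "simplicial_complex_on n \<Gamma>"
    and "complex_dim \<Gamma> = int d - 1"
    and "n \<ge> 9 * d + 1"
  shows "real (face_number (int d - 1) \<Gamma>) <
    1 / fact (n - d) *
      (\<Prod>i = 1..n - d.
         real (taylor_max_shift n (stanley_reisner_ideal n \<Gamma> :: 'k::field mpoly set) i))"
proof -
  let ?M = "taylor_max_shift n (stanley_reisner_ideal n \<Gamma> :: 'k mpoly set)"
  have "finite \<Gamma>"
    using assms(1) by (auto simp: simplicial_complex_on_def intro: finite_subset)
  have faces: "card F \<le> d" if "F \<in> \<Gamma>" for F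
  proof -
    have "face_dim F \<le> complex_dim \<Gamma>"
      unfolding complex_dim_def using \<open>finite \<Gamma>\<close> that by (intro Max_ge) auto
    then show ?thesis using assms(2) by (simp add: face_dim_def)
  qed
  have vertex: "{1} \<in> \<Gamma>" using assms(1,3) by (auto simp: simplicial_complex_on_def)
  then have "1 \<le> d" using faces by fastforce
  have "min (2 * i) (n - d) \<le> ?M i" if i: "i \<le> n - d" for i
  proof -
    obtain S where S: "S \<subseteq> minimal_nonfaces n \<Gamma>" "card S = i"
        "min (2 * i) (n - d) \<le> card (\<Union>S)"
      using exists_nonfaces_with_large_union[OF assms(1) _ faces i] vertex by blast
    then show ?thesis
      using card_Union_le_taylor_max_shift[OF S(1), where 'k = 'k] by simp
  qed
  then have shifts: "capped_even_prod (n - d) \<le> (\<Prod>i=1..n-d. real (?M i))"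
    unfolding prod_min_eq_capped_even_prod[symmetric] by (intro prod_mono) auto
  have "real (face_number (int d - 1) \<Gamma>) \<le> real (n choose d)"
    using face_number_le_choose[OF assms(1)] by simp
  also have "\<dots> = 1 / fact (n - d) * (fact n / fact d)"
    using assms(3) by (simp add: binomial_fact)
  also have "\<dots> < 1 / fact (n - d) * capped_even_prod (n - d)"
    using fact_quotient_less_capped_even_prod[of d "n - d"] \<open>1 \<le> d\<close> assms(3)
    by (intro mult_strict_left_mono) auto
  also have "\<dots> \<le> 1 / fact (n - d) * (\<Prod>i=1..n-d. real (?M i))"
    using shifts by (intro mult_left_mono) auto
  finally show ?thesis .
qed

end
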